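(* (Undefinability.) There exists an $\mathit{MSO}[<]$ formula $\Psi(X,Y)$ such that: (1) there is no $\mathit{MSO}[<]$-definable C-operator $F$ such that $\mathit{FVsig}\models \forall X.\ \Psi(X,F(X))$; and (2) there is a C-operator $F$ such that $\mathit{FVsig}\models \forall X.\ \Psi(X,F(X))$.
   Context: A (finitely variable) boolean signal is a function $f:\mathbb{R}^{\geq 0}\to\{0,1\}$ for which there is an unbounded strictly increasing sequence $0=\tau_0<\tau_1<\cdots$ of reals such that $f$ is constant on every open interval $(\tau_i,\tau_{i+1})$; a signal is identified with the subset of $\mathbb{R}^{\geq 0}$ where it is $1$. $\mathit{MSO}[<]$ is monadic second-order logic with atomic formulas $t<v$ and $X(t)$, boolean connectives, and first- and second-order quantifiers. $\mathit{FVsig}$ is the structure in which first-order variables range over $\mathbb{R}^{\geq 0}$ with its usual order and monadic second-order variables range over the finitely variable boolean signals. An operator is a function $F$ from signals to signals. $F$ is a C-operator (causal) if for every $t\geq 0$ and all signals $X_1,X_2$ that agree on $[0,t]$, $F(X_1)(t)=F(X_2)(t)$. An operator $F$ is $\mathit{MSO}[<]$-definable if there is an $\mathit{MSO}[<]$ formula $U(X,Y)$ such that for all signals $X,Y$: $\mathit{FVsig}\models U(X,Y)$ iff $Y=F(X)$. *)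

theory Defs
  imports "HOL-Analysis.Analysis"
begin

text \<open>A boolean signal on the nonnegative reals is represented by the subset of \<open>{0..}\<close> on which
  it is 1, so that equality of signals is equality of sets.\<close>

definition FVsig :: "real set set" where
  "FVsig = {X. X \<subseteq> {0..} \<and>
     (\<exists>\<tau> :: nat \<Rightarrow> real. \<tau> 0 = 0 \<and> strict_mono \<tau> \<and> \<not> bdd_above (range \<tau>) \<and>
        (\<forall>i. (\<lambda>t. t \<in> X) constant_on {\<tau> i<..<\<tau> (Suc i)}))}"

text \<open>First-order and monadic second-order variables are two separate sorts, each named by
  natural numbers.\<close>

datatype mso =
    Less nat nat
  | App nat nat  \<comment> \<open>\<open>App X t\<close> is the atom \<open>X(t)\<close>\<close>
  | Neg mso
  | Conj mso mso
  | Disj mso mso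
  | Imp mso mso
  | Ex1 nat mso
  | All1 nat mso
  | Ex2 nat mso
  | All2 nat mso

fun free1 :: "mso \<Rightarrow> nat set" where
  "free1 (Less t v) = {t, v}"
| "free1 (App X t) = {t}"
| "free1 (Neg \<phi>) = free1 \<phi>"
| "free1 (Conj \<phi> \<psi>) = free1 \<phi> \<union> free1 \<psi>"
| "free1 (Disj \<phi> \<psi>) = free1 \<phi> \<union> free1 \<psi>"
| "free1 (Imp \<phi> \<psi>) = free1 \<phi> \<union> free1 \<psi>"
| "free1 (Ex1 t \<phi>) = free1 \<phi> - {t}"
| "free1 (All1 t \<phi>) = free1 \<phi> - {t}"
| "free1 (Ex2 X \<phi>) = free1 \<phi>"
| "free1 (All2 X \<phi>) = free1 \<phi>"

fun free2 :: "mso \<Rightarrow> nat set" where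
  "free2 (Less t v) = {}"
| "free2 (App X t) = {X}"
| "free2 (Neg \<phi>) = free2 \<phi>"
| "free2 (Conj \<phi> \<psi>) = free2 \<phi> \<union> free2 \<psi>"
| "free2 (Disj \<phi> \<psi>) = free2 \<phi> \<union> free2 \<psi>"
| "free2 (Imp \<phi> \<psi>) = free2 \<phi> \<union> free2 \<psi>"
| "free2 (Ex1 t \<phi>) = free2 \<phi>"
| "free2 (All1 t \<phi>) = free2 \<phi>"
| "free2 (Ex2 X \<phi>) = free2 \<phi> - {X}"
| "free2 (All2 X \<phi>) = free2 \<phi> - {X}"

fun sat :: "(nat \<Rightarrow> real) \<Rightarrow> (nat \<Rightarrow> real set) \<Rightarrow> mso \<Rightarrow> bool" where
  "sat a b (Less t v) \<longleftrightarrow> a t < a v"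
| "sat a b (App X t) \<longleftrightarrow> a t \<in> b X"
| "sat a b (Neg \<phi>) \<longleftrightarrow> \<not> sat a b \<phi>"
| "sat a b (Conj \<phi> \<psi>) \<longleftrightarrow> sat a b \<phi> \<and> sat a b \<psi>"
| "sat a b (Disj \<phi> \<psi>) \<longleftrightarrow> sat a b \<phi> \<or> sat a b \<psi>"
| "sat a b (Imp \<phi> \<psi>) \<longleftrightarrow> (sat a b \<phi> \<longrightarrow> sat a b \<psi>)"
| "sat a b (Ex1 t \<phi>) \<longleftrightarrow> (\<exists>r\<in>{0..}. sat (a(t := r)) b \<phi>)"
| "sat a b (All1 t \<phi>) \<longleftrightarrow> (\<forall>r\<in>{0..}. sat (a(t := r)) b \<phi>)"
| "sat a b (Ex2 X \<phi>) \<longleftrightarrow> (\<exists>S\<in>FVsig. sat a (b(X := S)) \<phi>)"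
| "sat a b (All2 X \<phi>) \<longleftrightarrow> (\<forall>S\<in>FVsig. sat a (b(X := S)) \<phi>)"

text \<open>A formula \<open>\<phi>(X,Y)\<close> uses the second-order variables 0 and 1 for \<open>X\<close> and \<open>Y\<close> and has no
  other free variables, so the values assigned to the remaining variables below are immaterial.\<close>

definition formula_XY :: "mso \<Rightarrow> bool" where
  "formula_XY \<phi> \<longleftrightarrow> free1 \<phi> = {} \<and> free2 \<phi> \<subseteq> {0, 1}"

definition sat_XY :: "mso \<Rightarrow> real set \<Rightarrow> real set \<Rightarrow> bool" where
  "sat_XY \<phi> X Y \<longleftrightarrow> sat (\<lambda>_. 0) ((\<lambda>_. {})(0 := X, 1 := Y)) \<phi>"

text \<open>Only the values of \<open>F\<close> on signals matter.\<close>

definition signal_operator :: "(real set \<Rightarrow> real set) \<Rightarrow> bool" where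
  "signal_operator F \<longleftrightarrow> (\<forall>X\<in>FVsig. F X \<in> FVsig)"

definition C_operator :: "(real set \<Rightarrow> real set) \<Rightarrow> bool" where
  "C_operator F \<longleftrightarrow> signal_operator F \<and>
     (\<forall>t\<ge>0. \<forall>X1\<in>FVsig. \<forall>X2\<in>FVsig.
        (\<forall>s\<in>{0..t}. s \<in> X1 \<longleftrightarrow> s \<in> X2) \<longrightarrow> (t \<in> F X1 \<longleftrightarrow> t \<in> F X2))"

definition MSO_definable :: "(real set \<Rightarrow> real set) \<Rightarrow> bool" where
  "MSO_definable F \<longleftrightarrow>
     (\<exists>U. formula_XY U \<and> (\<forall>X\<in>FVsig. \<forall>Y\<in>FVsig. sat_XY U X Y \<longleftrightarrow> Y = F X))"

end

theory Submission
  imports Defs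
begin

text \<open>
  The formula says that \<open>Y\<close> contains some positive time and omits some positive time. The causal
  operator with constant value \<open>[1,\<infinity>)\<close> satisfies it. Truth of \<open>MSO[<]\<close> formulas is invariant under
  dilations of the time axis, so a definable operator maps the dilation-invariant signal \<open>\<emptyset>\<close> to a
  dilation-invariant signal, which is constant on the positive times.
\<close>

text \<open>Scaling a breakpoint sequence \<open>\<tau>\<close> of \<open>S\<close> by
  \<open>c\<close> gives one for the dilated signal: each scaled interval pulls back to an interval
  of \<open>\<tau>\<close>.\<close>

lemma FVsig_dilation:
  fixes c :: real
  assumes "c > 0" and "S \<in> FVsig"
  shows "(*) c ` S \<in> FVsig"
proof -
  obtain \<tau> :: "nat \<Rightarrow> real" where S: "S \<subseteq> {0..}" and \<tau>: "\<tau> 0 = 0" "strict_mono \<tau>"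
      "\<not> bdd_above (range \<tau>)" "\<And>i. (\<lambda>t. t \<in> S) constant_on {\<tau> i<..<\<tau> (Suc i)}"
    using assms(2) unfolding FVsig_def by auto
  have mem: "t \<in> (*) c ` S \<longleftrightarrow> t / c \<in> S" for t
    using assms(1) by (auto simp: image_iff field_simps intro: bexI[of _ "t / c"])
  have "strict_mono (\<lambda>i. c * \<tau> i)"
    using \<tau>(2) assms(1) by (simp add: strict_mono_def)
  moreover have "\<not> bdd_above (range (\<lambda>i. c * \<tau> i))"
  proof
    assume "bdd_above (range (\<lambda>i. c * \<tau> i))"
    then obtain M where "c * \<tau> i \<le> M" for i
      by (auto simp: bdd_above_def)
    then have "\<tau> i \<le> M / c" for i
      using assms(1) by (simp add: field_simps)
    then show False
      using \<tau>(3) by (auto simp: bdd_above_def)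
  qed
  moreover have "(\<lambda>t. t \<in> (*) c ` S) constant_on {c * \<tau> i<..<c * \<tau> (Suc i)}" for i
  proof -
    obtain k where k: "\<And>t. t \<in> {\<tau> i<..<\<tau> (Suc i)} \<Longrightarrow> (t \<in> S) = k"
      using \<tau>(4)[of i] unfolding constant_on_def by blast
    have "(t / c \<in> S) = k" if "t \<in> {c * \<tau> i<..<c * \<tau> (Suc i)}" for t
      using that assms(1) by (intro k) (simp add: field_simps)
    then show ?thesis
      unfolding mem constant_on_def by blast
  qed
  moreover have "(*) c ` S \<subseteq> {0..}"
    using S assms(1) by auto
  ultimately show ?thesis
    using \<tau>(1) unfolding FVsig_def by (auto intro!: exI[of _ "\<lambda>i. c * \<tau> i"])
qed

text \<open>Surjectivity comes from dilating by \<open>inverse c\<close>. An equality is needed,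
  since second-order quantifiers of both kinds are to be reindexed along the dilation.\<close>

lemma image_dilation_FVsig:
  fixes c :: real
  assumes "c > 0"
  shows "(`) ((*) c) ` FVsig = FVsig"
proof
  show "(`) ((*) c) ` FVsig \<subseteq> FVsig"
    using FVsig_dilation[OF assms] by blast
  show "FVsig \<subseteq> (`) ((*) c) ` FVsig"
  proof
    fix S assume "S \<in> FVsig"
    then have "(*) (inverse c) ` S \<in> FVsig"
      using assms by (intro FVsig_dilation) auto
    moreover have "S = (*) c ` (*) (inverse c) ` S"
      using assms by (simp add: image_image flip: mult.assoc)
    ultimately show "S \<in> (`) ((*) c) ` FVsig"
      by (rule rev_image_eqI)
  qed
qed

lemma image_dilation_nonneg:
  fixes c :: real
  assumes "c > 0"
  shows "(*) c ` {0..} = {0..}"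
proof
  show "{0..} \<subseteq> (*) c ` {0..}"
    using assms by (auto intro!: image_eqI[of _ _ "_ / c"])
qed (use assms in auto)

text \<open>For \<open>c > 0\<close> the dilation is an automorphism of the structure: it preserves
  order and membership in both directions and permutes both quantifier ranges. The assignments are
  generalized because quantifiers update them.\<close>

lemma sat_dilation:
  assumes "c > 0"
  shows "sat (\<lambda>i. c * a i) (\<lambda>i. (*) c ` b i) \<phi> \<longleftrightarrow> sat a b \<phi>"
proof (induction \<phi> arbitrary: a b)
  \<comment> \<open>Updating a scaled assignment with a scaled value is scaling the updated
    assignment, the shape to which the induction hypothesis applies.\<close>
  have upd1: "(\<lambda>i. c * a i)(t := c * r) = (\<lambda>i. c * (a(t := r)) i)" for a :: "nat \<Rightarrow> real" and t r
    by auto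
  have upd2: "(\<lambda>i. (*) c ` b i)(X := (*) c ` S) = (\<lambda>i. (*) c ` (b(X := S)) i)"
    for b :: "nat \<Rightarrow> real set" and X S
    by (rule ext) simp
  note nonneg = image_dilation_nonneg[OF assms] and FV = image_dilation_FVsig[OF assms]
  {
    case (Less t v)
    then show ?case using assms by simp
  next
    case (App X t)
    then show ?case using assms by auto
  next
    case (Ex1 t \<phi>)
    \<comment> \<open>The range is written as its own image, so that every value considered is a
      scaled one; the other quantifiers are treated alike.\<close>
    have "sat (\<lambda>i. c * a i) (\<lambda>i. (*) c ` b i) (Ex1 t \<phi>) \<longleftrightarrow>
        (\<exists>r\<in>(*) c ` {0..}. sat ((\<lambda>i. c * a i)(t := r)) (\<lambda>i. (*) c ` b i) \<phi>)"
      by (simp add: nonneg)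
    also have "\<dots> \<longleftrightarrow> sat a b (Ex1 t \<phi>)"
      unfolding bex_simps(7) upd1 Ex1.IH by (simp only: sat.simps)
    finally show ?case .
  next
    case (All1 t \<phi>)
    have "sat (\<lambda>i. c * a i) (\<lambda>i. (*) c ` b i) (All1 t \<phi>) \<longleftrightarrow>
        (\<forall>r\<in>(*) c ` {0..}. sat ((\<lambda>i. c * a i)(t := r)) (\<lambda>i. (*) c ` b i) \<phi>)"
      by (simp add: nonneg)
    also have "\<dots> \<longleftrightarrow> sat a b (All1 t \<phi>)"
      unfolding ball_simps(9) upd1 All1.IH by (simp only: sat.simps)
    finally show ?case .
  next
    case (Ex2 X \<phi>)
    have "sat (\<lambda>i. c * a i) (\<lambda>i. (*) c ` b i) (Ex2 X \<phi>) \<longleftrightarrow>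
        (\<exists>S\<in>(`) ((*) c) ` FVsig. sat (\<lambda>i. c * a i) ((\<lambda>i. (*) c ` b i)(X := S)) \<phi>)"
      by (simp only: sat.simps FV)
    also have "\<dots> \<longleftrightarrow> sat a b (Ex2 X \<phi>)"
      unfolding bex_simps(7) upd2 Ex2.IH by (simp only: sat.simps)
    finally show ?case .
  next
    case (All2 X \<phi>)
    have "sat (\<lambda>i. c * a i) (\<lambda>i. (*) c ` b i) (All2 X \<phi>) \<longleftrightarrow>
        (\<forall>S\<in>(`) ((*) c) ` FVsig. sat (\<lambda>i. c * a i) ((\<lambda>i. (*) c ` b i)(X := S)) \<phi>)"
      by (simp only: sat.simps FV)
    also have "\<dots> \<longleftrightarrow> sat a b (All2 X \<phi>)"
      unfolding ball_simps(9) upd2 All2.IH by (simp only: sat.simps)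
    finally show ?case .
  }
qed simp_all

text \<open>The default values 0 and \<open>{}\<close> of the remaining variables are fixed by every
  dilation.\<close>

lemma sat_XY_dilation:
  assumes "c > 0"
  shows "sat_XY \<phi> ((*) c ` X) ((*) c ` Y) \<longleftrightarrow> sat_XY \<phi> X Y"
proof -
  have "(\<lambda>_. {})(0 := (*) c ` X, 1 := (*) c ` Y) = (\<lambda>i::nat. (*) c ` ((\<lambda>_. {})(0 := X, 1 := Y)) i)"
    by (rule ext) simp
  then show ?thesis
    unfolding sat_XY_def using sat_dilation[OF assms, of "\<lambda>_. 0"] by (simp only: mult_zero_right)
qed

lemma FVsig_constant_on_unit_intervals:
  assumes "X \<subseteq> {0..}" and "\<And>i::nat. (\<lambda>t. t \<in> X) constant_on {real i<..<real (Suc i)}"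
  shows "X \<in> FVsig"
proof -
  have "\<not> bdd_above (range real)"
    by (auto simp: bdd_above_def not_le intro: reals_Archimedean2)
  then show ?thesis
    unfolding FVsig_def using assms by (auto simp: strict_mono_def intro!: exI[of _ real])
qed

lemma empty_in_FVsig: "{} \<in> FVsig"
  by (rule FVsig_constant_on_unit_intervals) (auto simp: constant_on_def)

lemma atLeast_1_in_FVsig: "{1..} \<in> FVsig"
proof (rule FVsig_constant_on_unit_intervals)
  show "(\<lambda>t. t \<in> {1..}) constant_on {real i<..<real (Suc i)}" for i
    \<comment> \<open>The jump at 1 is a breakpoint: the interval with \<open>i = 0\<close> lies
      outside the signal, all later ones inside.\<close>
    unfolding constant_on_def by (cases i) (auto intro!: exI[of _ "i \<noteq> 0"])
qed auto

text \<open>As \<open>{}\<close> is fixed by dilation, the dilated output satisfies the defining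
  formula for the same input, and that formula has only one solution among signals.\<close>

lemma MSO_definable_empty_dilation:
  assumes "MSO_definable F" and "signal_operator F" and "c > 0"
  shows "(*) c ` F {} = F {}"
proof -
  obtain U where U: "\<And>Y. Y \<in> FVsig \<Longrightarrow> sat_XY U {} Y \<longleftrightarrow> Y = F {}"
    using assms(1) empty_in_FVsig unfolding MSO_definable_def by blast
  have F: "F {} \<in> FVsig"
    using assms(2) empty_in_FVsig by (simp add: signal_operator_def)
  then have "sat_XY U {} ((*) c ` F {})"
    using sat_XY_dilation[OF assms(3), of U "{}" "F {}"] U by simp
  then show ?thesis
    using U FVsig_dilation[OF assms(3) F] by blast
qed

theorem theorem1p4:
  shows "\<exists>\<Psi>. formula_XY \<Psi> \<and>
    \<not> (\<exists>F. C_operator F \<and> MSO_definable F \<and> (\<forall>X\<in>FVsig. sat_XY \<Psi> X (F X))) \<and>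
    (\<exists>F. C_operator F \<and> (\<forall>X\<in>FVsig. sat_XY \<Psi> X (F X)))"
proof -
  \<comment> \<open>Variable 0 lies below both witnesses and so forces them to be positive. Time 0
    must be excluded: \<open>{0}\<close> is dilation-invariant but neither empty nor all of
    \<open>{0..}\<close>.\<close>
  define \<Psi> where "\<Psi> = Ex1 0 (Ex1 1 (Ex1 2 (Conj (Conj (Less 0 1) (Less 0 2))
    (Conj (App 1 1) (Neg (App 1 2))))))"
  have sat_\<Psi>: "sat_XY \<Psi> X Y \<longleftrightarrow> (\<exists>r\<ge>0. \<exists>p\<ge>0. \<exists>q\<ge>0. r < p \<and> r < q \<and> p \<in> Y \<and> q \<notin> Y)" for X Y
    by (auto simp: \<Psi>_def sat_XY_def)
  have "formula_XY \<Psi>"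
    by (auto simp: formula_XY_def \<Psi>_def)
  moreover have "\<not> (\<exists>F. C_operator F \<and> MSO_definable F \<and> (\<forall>X\<in>FVsig. sat_XY \<Psi> X (F X)))"
  proof
    assume "\<exists>F. C_operator F \<and> MSO_definable F \<and> (\<forall>X\<in>FVsig. sat_XY \<Psi> X (F X))"
    then obtain F where "C_operator F" and F: "MSO_definable F"
        and sat_F: "\<forall>X\<in>FVsig. sat_XY \<Psi> X (F X)"
      by (elim exE conjE)
    then have signal: "signal_operator F"
      by (simp add: C_operator_def)
    have "sat_XY \<Psi> {} (F {})"
      using sat_F empty_in_FVsig by (rule bspec)
    then obtain r p q :: real where "r \<ge> 0" "r < p" "r < q" and pq: "p \<in> F {}" "q \<notin> F {}"
      unfolding sat_\<Psi> by blast
    then have "p > 0" "q > 0"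
      by linarith+
    \<comment> \<open>The factor is chosen to carry \<open>p\<close> to \<open>q\<close>, which puts
      \<open>q\<close> into \<open>F {}\<close>.\<close>
    then have "(*) (q / p) ` F {} = F {}"
      by (intro MSO_definable_empty_dilation F signal) simp
    moreover have "q = q / p * p"
      using \<open>p > 0\<close> by simp
    ultimately show False
      using pq by blast
  qed
  moreover have "\<exists>F. C_operator F \<and> (\<forall>X\<in>FVsig. sat_XY \<Psi> X (F X))"
  proof (intro exI conjI ballI)
    show "C_operator (\<lambda>_. {1..})"
      by (simp add: C_operator_def signal_operator_def atLeast_1_in_FVsig)
    \<comment> \<open>With lower bound 0, the time 1 lies in the output and 1/2 does not.\<close>
    show "sat_XY \<Psi> X {1..}" for X
      unfolding sat_\<Psi>
      by (rule exI[of _ 0], rule conjI[OF order_refl], rule exI[of _ 1], rule conjI[OF zero_le_one],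
        rule exI[of _ "1/2"]) simp
  qed
  ultimately show ?thesis
    by blast
qed

end
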